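(* Let $\mathrm{G}=\{\mathcal N, J_i,\mathbb R\}$ be an $N$-player noncooperative game ($N\ge 2$) and let $\mathcal G$ be a weighted digraph on $\mathcal N=\{1,\dots,N\}$ with Laplacian $L$. Suppose that: (1) for each $i\in\mathcal N$, $J_i(z_i,\boldsymbol z_{-i})$ is twice continuously differentiable, and strictly convex and radially unbounded in $z_i\in\mathbb R$ for any fixed $\boldsymbol z_{-i}\in\mathbb R^{N-1}$; (2) the pseudogradient $F:\mathbb R^N\to\mathbb R^N$ is $\underline l$-strongly monotone and $\bar l$-Lipschitz for constants $\underline l,\bar l>0$; (3) the extended pseudogradient $\boldsymbol F:\mathbb R^{N^2}\to\mathbb R^N$ is $l_F$-Lipschitz with $l_F>0$; (4) $\mathcal G$ is strongly connected; (5) $\mathcal G$ is weight-balanced. Let $l=\max\{\bar l,l_F\}$, let $\lambda_2$ be the smallest positive eigenvalue of $\mathrm{Sym}(L)=\frac{L+L^\top}{2}$, and let $\alpha>\frac{1}{\lambda_2}\left(\frac{l^2}{\underline l}+l\right)$. Then, for any $i\in\mathcal N$, along any trajectory of the system $$\dot{\mathbf z}=-\alpha (L\otimes I_N)\mathbf z-R\,\boldsymbol F(\mathbf z),\qquad \mathbf z=\mathrm{col}(\mathbf z^1,\dots,\mathbf z^N)\in\mathbb R^{N^2},$$ that is, $\dot{\mathbf z}^i=-\alpha\sum_{j=1}^N a_{ij}(\mathbf z^i-\mathbf z^j)-R_i\nabla_iJ_i(\mathbf z^i)$ for $i\in\mathcal N$, the component $\mathbf z^i(t)$ converges exponentially to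 the Nash equilibrium $z^*$ of $\mathrm G$ as $t\to+\infty$.
   Context: Game. Player $i\in\mathcal N=\{1,\dots,N\}$ has decision $z_i\in\mathbb R$ and a cost function $J_i(z_i,\boldsymbol z_{-i})$, where $\boldsymbol z_{-i}\in\mathbb R^{N-1}$ collects the decisions of all other players; $z=\mathrm{col}(z_1,\dots,z_N)$, where $\mathrm{col}$ denotes stacking of column vectors. A Nash equilibrium is $z^*=\mathrm{col}(z_1^*,\dots,z_N^* )$ with $J_i(z_i^*,\boldsymbol z_{-i}^* )\le J_i(z_i,\boldsymbol z_{-i}^* )$ for all $i\in\mathcal N$ and $z_i\in\mathbb R$. Under hypotheses (1) and (2) the game has a unique Nash equilibrium $z^*$, characterized by $F(z^* )=0$. Write $\nabla_iJ_i(z)=\frac{\partial J_i}{\partial z_i}(z_i,\boldsymbol z_{-i})\in\mathbb R$. The pseudogradient is $F(z)=\mathrm{col}(\nabla_1J_1(z),\dots,\nabla_NJ_N(z))$ for $z\in\mathbb R^N$. For $\mathbf z=\mathrm{col}(\mathbf z^1,\dots,\mathbf z^N)$ with $\mathbf z^i=\mathrm{col}(z^i_1,\dots,z^i_N)\in\mathbb R^N$ (player $i$'s estimate of all players' decisions, with $z_i^i=z_i$), $\nabla_iJ_i(\mathbf z^i)$ is the same partial derivative evaluated at $\mathbf z^i$, and the extended pseudogradient is $\boldsymbol F(\mathbf z)=\mathrm{col}(\nabla_1J_1(\mathbf z^1),\dots,\nabla_NJ_N(\mathbf z^N))\in\mathbb R^N$. $R_i\in\mathbb R^N$ is the $i$-th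 standard basis vector, and $R=\mathrm{diag}(R_1,\dots,R_N)\in\mathbb R^{N^2\times N}$ is block diagonal. $\Phi:\mathbb R^m\to\mathbb R^m$ is $\omega$-strongly monotone if $(\zeta_1-\zeta_2)^\top[\Phi(\zeta_1)-\Phi(\zeta_2)]\ge\omega\|\zeta_1-\zeta_2\|^2$ for all $\zeta_1,\zeta_2$; a map $\Phi$ is $\vartheta$-Lipschitz if $\|\Phi(\zeta_1)-\Phi(\zeta_2)\|\le\vartheta\|\zeta_1-\zeta_2\|$ for all $\zeta_1,\zeta_2$ (Euclidean norms). Graph. A weighted digraph $\mathcal G=(\mathcal N,\mathcal E,\mathcal A)$ has adjacency matrix $\mathcal A=[a_{ij}]\in\mathbb R^{N\times N}$ with $a_{ii}=0$, $a_{ij}\ge0$, and $a_{ij}>0$ iff there is an edge $(j,i)\in\mathcal E$ from $j$ to $i$. It is strongly connected if there is a directed path between any two nodes (in each direction). It is weight-balanced if $\sum_ja_{ij}=\sum_ja_{ji}$ for every $i$. The Laplacian is $L=D^{\mathrm{in}}-\mathcal A$ with $D^{\mathrm{in}}=\mathrm{diag}(\sum_ja_{1j},\dots,\sum_ja_{Nj})$. For a weight-balanced, strongly connected digraph, $\mathrm{Sym}(L)$ is positive semidefinite with eigenvalues $0=\lambda_1<\lambda_2\le\dots\le\lambda_N$. Exponential convergence of $x(t)$ to $x^*$ means there are constants $c,\beta>0$ with $\|x(t)-x^*\|\le c\,e^{-\beta t}$ for all $t\ge0$. *)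

theory Defs
  imports "HOL-Analysis.Analysis"
begin

text \<open>The players are the elements of the finite type \<open>'n\<close>. The cost \<open>J i\<close> takes the whole
  decision profile \<open>z = (z\<^sub>i, z\<^sub>-\<^sub>i)\<close>; \<open>deviate z i x\<close> is the profile \<open>(x, z\<^sub>-\<^sub>i)\<close>.\<close>

definition deviate :: "real^'n \<Rightarrow> 'n \<Rightarrow> real \<Rightarrow> real^'n" where
  "deviate z i x = (\<chi> j. if j = i then x else z $ j)"

definition nash_equilibrium :: "('n \<Rightarrow> real^'n \<Rightarrow> real) \<Rightarrow> real^'n \<Rightarrow> bool" where
  "nash_equilibrium J zs \<longleftrightarrow> (\<forall>i x. J i zs \<le> J i (deviate zs i x))"

definition own_partial :: "('n \<Rightarrow> real^'n \<Rightarrow> real) \<Rightarrow> 'n \<Rightarrow> real^'n \<Rightarrow> real" where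
  "own_partial J i z = deriv (\<lambda>x. J i (deviate z i x)) (z $ i)"

definition pseudogradient :: "('n \<Rightarrow> real^'n \<Rightarrow> real) \<Rightarrow> real^'n \<Rightarrow> real^'n" where
  "pseudogradient J z = (\<chi> i. own_partial J i z)"

definition twice_continuously_differentiable :: "('a::real_normed_vector \<Rightarrow> real) \<Rightarrow> bool" where
  "twice_continuously_differentiable f \<longleftrightarrow>
    (\<exists>(f' :: 'a \<Rightarrow> 'a \<Rightarrow>\<^sub>L real) (f'' :: 'a \<Rightarrow> 'a \<Rightarrow>\<^sub>L 'a \<Rightarrow>\<^sub>L real).
      (\<forall>x. (f has_derivative blinfun_apply (f' x)) (at x)) \<and>
      (\<forall>x. (f' has_derivative blinfun_apply (f'' x)) (at x)) \<and>
      continuous_on UNIV f'')"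

definition strictly_convex :: "(real \<Rightarrow> real) \<Rightarrow> bool" where
  "strictly_convex f \<longleftrightarrow>
    (\<forall>x y t. x \<noteq> y \<longrightarrow> 0 < t \<longrightarrow> t < 1 \<longrightarrow>
      f ((1 - t) * x + t * y) < (1 - t) * f x + t * f y)"

definition radially_unbounded :: "(real \<Rightarrow> real) \<Rightarrow> bool" where
  "radially_unbounded f \<longleftrightarrow> filterlim f at_top at_infinity"

definition strongly_monotone :: "real \<Rightarrow> ('a::real_inner \<Rightarrow> 'a) \<Rightarrow> bool" where
  "strongly_monotone \<omega> \<Phi> \<longleftrightarrow>
    (\<forall>x y. (x - y) \<bullet> (\<Phi> x - \<Phi> y) \<ge> \<omega> * (norm (x - y))\<^sup>2)"

text \<open>A vector of length \<open>N\<^sup>2\<close> stacking \<open>N\<close> blocks of length \<open>N\<close> is indexed by \<open>'n \<times> 'n\<close>: entry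
  \<open>(i, k)\<close> is the \<open>k\<close>-th entry of the \<open>i\<close>-th block.\<close>

definition block :: "real^('n \<times> 'n) \<Rightarrow> 'n \<Rightarrow> real^'n" where
  "block Z i = (\<chi> k. Z $ (i, k))"

definition extended_pseudogradient ::
    "('n \<Rightarrow> real^'n \<Rightarrow> real) \<Rightarrow> real^('n \<times> 'n) \<Rightarrow> real^'n" where
  "extended_pseudogradient J Z = (\<chi> i. own_partial J i (block Z i))"

definition kronecker ::
    "real^'b^'a \<Rightarrow> real^'d^'c \<Rightarrow> real^('b \<times> 'd)^('a \<times> 'c)" where
  "kronecker A B = (\<chi> p q. A $ fst p $ fst q * B $ snd p $ snd q)"

text \<open>The block diagonal matrix \<open>diag(R\<^sub>1, \<dots>, R\<^sub>N)\<close>, where \<open>R\<^sub>i = axis i 1\<close>.\<close>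

definition selection_matrix :: "real^'n^('n \<times> 'n)" where
  "selection_matrix = (\<chi> p j. if fst p = j then axis j 1 $ snd p else 0)"

definition weighted_digraph :: "('n \<times> 'n) set \<Rightarrow> real^'n^'n \<Rightarrow> bool" where
  "weighted_digraph E A \<longleftrightarrow>
    (\<forall>i. A $ i $ i = 0) \<and> (\<forall>i j. 0 \<le> A $ i $ j) \<and> (\<forall>i j. 0 < A $ i $ j \<longleftrightarrow> (j, i) \<in> E)"

definition strongly_connected :: "('n \<times> 'n) set \<Rightarrow> bool" where
  "strongly_connected E \<longleftrightarrow> (\<forall>i j. (i, j) \<in> E\<^sup>*)"

definition weight_balanced :: "real^'n^'n \<Rightarrow> bool" where
  "weight_balanced A \<longleftrightarrow> (\<forall>i. (\<Sum>j\<in>UNIV. A $ i $ j) = (\<Sum>j\<in>UNIV. A $ j $ i))"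

definition laplacian :: "real^'n^'n \<Rightarrow> real^'n^'n" where
  "laplacian A = (\<chi> i j. if i = j then \<Sum>k\<in>UNIV. A $ i $ k else 0) - A"

definition sym_part :: "real^'n^'n \<Rightarrow> real^'n^'n" where
  "sym_part M = (1/2) *\<^sub>R (M + transpose M)"

definition is_eigenvalue :: "real^'n^'n \<Rightarrow> real \<Rightarrow> bool" where
  "is_eigenvalue M \<mu> \<longleftrightarrow> (\<exists>v. v \<noteq> 0 \<and> M *v v = \<mu> *\<^sub>R v)"

definition smallest_positive_eigenvalue :: "real^'n^'n \<Rightarrow> real" where
  "smallest_positive_eigenvalue M = (LEAST \<mu>. 0 < \<mu> \<and> is_eigenvalue M \<mu>)"

definition seeking_field ::
    "('n \<Rightarrow> real^'n \<Rightarrow> real) \<Rightarrow> real^'n^'n \<Rightarrow> real \<Rightarrow> real^('n \<times> 'n) \<Rightarrow> real^('n \<times> 'n)" where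
  "seeking_field J A \<alpha> Z =
    - (\<alpha> *\<^sub>R (kronecker (laplacian A) (mat 1 :: real^'n^'n) *v Z))
    - selection_matrix *v extended_pseudogradient J Z"

definition is_trajectory :: "('a::real_normed_vector \<Rightarrow> 'a) \<Rightarrow> (real \<Rightarrow> 'a) \<Rightarrow> bool" where
  "is_trajectory f x \<longleftrightarrow> (\<forall>t\<ge>0. (x has_vector_derivative f (x t)) (at t within {0..}))"

definition converges_exponentially :: "(real \<Rightarrow> 'a::real_normed_vector) \<Rightarrow> 'a \<Rightarrow> bool" where
  "converges_exponentially x xs \<longleftrightarrow>
    (\<exists>c>0. \<exists>\<beta>>0. \<forall>t\<ge>0. norm (x t - xs) \<le> c * exp (- \<beta> * t))"

lemma block_seeking_field:
  fixes J :: "'n::finite \<Rightarrow> real^'n \<Rightarrow> real"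
  shows "block (seeking_field J A \<alpha> Z) i =
    - (\<alpha> *\<^sub>R (\<Sum>j\<in>UNIV. A $ i $ j *\<^sub>R (block Z i - block Z j)))
    - own_partial J i (block Z i) *\<^sub>R axis i 1"
proof -
  have 1: "(kronecker (laplacian A) (mat 1 :: real^'n^'n) *v Z) $ (i, k)
      = (\<Sum>j\<in>UNIV. A $ i $ j * (Z $ (i, k) - Z $ (j, k)))" for k
  proof -
    have "(kronecker (laplacian A) (mat 1 :: real^'n^'n) *v Z) $ (i, k)
        = (\<Sum>j\<in>UNIV. \<Sum>m\<in>UNIV. laplacian A $ i $ j * (mat 1 :: real^'n^'n) $ k $ m * Z $ (j, m))"
      by (simp add: matrix_vector_mult_def kronecker_def sum.cartesian_product case_prod_unfold
          flip: UNIV_Times_UNIV)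
    also have "\<dots> = (\<Sum>j\<in>UNIV. laplacian A $ i $ j * Z $ (j, k))"
      by (simp add: mat_def if_distrib if_distribR cong: if_cong)
    also have "\<dots> = (\<Sum>j\<in>UNIV. (if i = j then (\<Sum>k\<in>UNIV. A $ i $ k) * Z $ (j, k) else 0)
        - A $ i $ j * Z $ (j, k))"
      by (intro sum.cong) (auto simp: laplacian_def algebra_simps)
    also have "\<dots> = (\<Sum>j\<in>UNIV. A $ i $ j * (Z $ (i, k) - Z $ (j, k)))"
      by (simp add: sum_subtractf right_diff_distrib sum_distrib_right)
    finally show ?thesis .
  qed
  have 2: "(selection_matrix *v extended_pseudogradient J Z) $ (i, k)
      = own_partial J i (block Z i) * axis i 1 $ k" for k
    by (simp add: matrix_vector_mult_def selection_matrix_def extended_pseudogradient_def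
        if_distrib if_distribR mult.commute cong: if_cong)
  show ?thesis
    by (simp add: vec_eq_iff block_def seeking_field_def 1 2[unfolded block_def])
qed

end

theory Submission
  imports Defs
begin

text \<open>
  Split the error of each block as \<open>\<^bold>z\<^sup>i - z\<^sup>* = m + d\<^sup>i\<close>, where \<open>m\<close> is the mean error and the
  disagreements \<open>d\<^sup>i\<close> sum to zero. The Laplacian acts only on \<open>d\<close> and, by the Rayleigh quotient
  characterization of \<open>\<lambda>\<^sub>2\<close>, dissipates at least \<open>\<alpha> \<lambda>\<^sub>2 \<bar>d\<bar>\<^sup>2\<close>. Strong monotonicity at the consensus
  point \<open>z\<^sup>* + m\<close> dissipates \<open>l_low \<bar>m\<bar>\<^sup>2\<close>, and the Lipschitz bounds control the remaining terms by
  \<open>2 l \<bar>m\<bar> \<bar>d\<bar> + l \<bar>d\<bar>\<^sup>2\<close>. The resulting quadratic form in \<open>(\<bar>m\<bar>, \<bar>d\<bar>)\<close> is positive definite exactly when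
  \<open>l\<^sup>2 < l_low (\<alpha> \<lambda>\<^sub>2 - l)\<close>, which is the condition on \<open>\<alpha>\<close>; hence the squared error decays exponentially.
\<close>

section \<open>Rayleigh quotients of a symmetric matrix, orthogonally to a kernel vector\<close>

lemma symmetric_matrix_inner:
  fixes S :: "real^'n^'n"
  assumes "transpose S = S"
  shows "x \<bullet> (S *v y) = (S *v x) \<bullet> y"
  by (metis assms dot_lmul_matrix vector_transpose_matrix)

text \<open>For small \<open>t\<close> of sign opposite to \<open>b\<close> the linear term would
  dominate. This serves as the first-order condition at a constrained minimum.\<close>

lemma nonneg_quadratic_imp_linear_coeff_zero:
  fixes b c :: real
  assumes "\<And>t. 0 \<le> 2 * t * b + t\<^sup>2 * c" "0 \<le> c"
  shows "b = 0"
proof -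
  \<comment> \<open>At \<open>t = - s\<close> the quadratic collapses to
    \<open>- (s^2 * (c + 2))\<close>; the \<open>+ 1\<close> keeps the denominator positive when
    \<open>c = 0\<close>.\<close>
  define s where "s = b / (c + 1)"
  have b: "b = s * (c + 1)" using assms(2) by (simp add: s_def)
  have "0 \<le> 2 * (- s) * b + (- s)\<^sup>2 * c" by (rule assms(1))
  also have "\<dots> = - (s\<^sup>2 * (c + 2))" by (simp add: b power2_eq_square algebra_simps)
  finally have "s\<^sup>2 * (c + 2) \<le> 0" by simp
  then have "s = 0" using assms(2)
    by (metis add_nonneg_pos linorder_not_le mult_pos_pos zero_less_numeral zero_less_power2)
  then show ?thesis using b by simp
qed

text \<open>By compactness the form attains a minimum on the unit vectors orthogonal to
  \<open>u\<close>, and a minimizer is an eigenvector. By symmetry every eigenvector with a positive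
  eigenvalue is orthogonal to \<open>u\<close>, so this minimum is the least positive eigenvalue; in
  particular the \<open>LEAST\<close> of the definition is attained.\<close>

lemma smallest_positive_eigenvalue_rayleigh:
  fixes S :: "real^'n::finite^'n" and u :: "real^'n"
  assumes sym: "transpose S = S" and ker: "S *v u = 0"
    and pos: "\<And>x. x \<bullet> u = 0 \<Longrightarrow> x \<noteq> 0 \<Longrightarrow> 0 < x \<bullet> (S *v x)"
    and ex: "\<exists>x. x \<noteq> 0 \<and> x \<bullet> u = 0"
  shows "0 < smallest_positive_eigenvalue S"
    and "\<And>x. x \<bullet> u = 0 \<Longrightarrow> smallest_positive_eigenvalue S * (x \<bullet> x) \<le> x \<bullet> (S *v x)"
proof -
  define K where "K = sphere 0 1 \<inter> {x. u \<bullet> x = 0}"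
  have "compact K"
    unfolding K_def by (intro compact_Int_closed compact_sphere closed_hyperplane)
  moreover have "K \<noteq> {}"
  proof -
    obtain x where "x \<noteq> 0" "x \<bullet> u = 0" using ex by blast
    then have "(1 / norm x) *\<^sub>R x \<in> K" by (simp add: K_def inner_commute)
    then show ?thesis by blast
  qed
  moreover have "continuous_on K (\<lambda>x. x \<bullet> (S *v x))"
    by (intro continuous_on_inner continuous_on_id matrix_vector_mult_linear_continuous_on)
  ultimately obtain v where vK: "v \<in> K" and vmin: "\<And>x. x \<in> K \<Longrightarrow> v \<bullet> (S *v v) \<le> x \<bullet> (S *v x)"
    using continuous_attains_inf[of K "\<lambda>x. x \<bullet> (S *v x)"] by metis
  define \<mu> where "\<mu> = v \<bullet> (S *v v)"
  have v: "norm v = 1" "v \<bullet> u = 0" using vK by (auto simp: K_def inner_commute)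
  then have v0: "v \<noteq> 0" by auto
  have mu_pos: "0 < \<mu>" unfolding \<mu>_def using pos v(2) v0 by blast
  have ray: "\<mu> * (x \<bullet> x) \<le> x \<bullet> (S *v x)" if "x \<bullet> u = 0" for x
  proof (cases "x = 0")
    case False
    define y where "y = (1 / norm x) *\<^sub>R x"
    have "y \<in> K" using False that by (simp add: y_def K_def inner_commute)
    then have "\<mu> \<le> y \<bullet> (S *v y)" using vmin by (simp add: \<mu>_def)
    also have "\<dots> = (x \<bullet> (S *v x)) / (x \<bullet> x)"
      by (simp add: y_def matrix_vector_mult_scaleR dot_square_norm power2_eq_square)
    finally show ?thesis using False by (simp add: field_simps)
  qed simp
  \<comment> \<open>The residual \<open>g\<close> is again orthogonal to \<open>u\<close>, so
    \<open>v\<close> may be perturbed along it. The Rayleigh inequality at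
    \<open>v + t *\<^sub>R g\<close> has no constant term and linear coefficient
    \<open>2 * (g \<bullet> g)\<close>, which must therefore vanish.\<close>
  define g where "g = S *v v - \<mu> *\<^sub>R v"
  have gu: "g \<bullet> u = 0"
    using v(2) ker symmetric_matrix_inner[OF sym, of v u] by (simp add: g_def inner_diff_left)
  have "g \<bullet> g = 0"
  proof (rule nonneg_quadratic_imp_linear_coeff_zero)
    show "0 \<le> g \<bullet> (S *v g) - \<mu> * (g \<bullet> g)" using ray[OF gu] by simp
    fix t :: real
    have "(v + t *\<^sub>R g) \<bullet> u = 0" using v(2) gu by (simp add: inner_add_left)
    from ray[OF this]
    have 1: "0 \<le> (v + t *\<^sub>R g) \<bullet> (S *v (v + t *\<^sub>R g)) - \<mu> * ((v + t *\<^sub>R g) \<bullet> (v + t *\<^sub>R g))"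
      by simp
    have 2: "v \<bullet> (S *v g) = g \<bullet> (S *v v)"
      using symmetric_matrix_inner[OF sym, of v g] by (simp add: inner_commute)
    have 3: "g \<bullet> (S *v v) = g \<bullet> g + \<mu> * (v \<bullet> g)"
      by (simp add: g_def inner_diff_left inner_diff_right inner_commute algebra_simps)
    have 4: "v \<bullet> (S *v v) = \<mu> * (v \<bullet> v)" using v(1) by (simp add: \<mu>_def dot_square_norm)
    have "(v + t *\<^sub>R g) \<bullet> (S *v (v + t *\<^sub>R g)) - \<mu> * ((v + t *\<^sub>R g) \<bullet> (v + t *\<^sub>R g))
      = 2 * t * (g \<bullet> g) + t\<^sup>2 * (g \<bullet> (S *v g) - \<mu> * (g \<bullet> g))"
      by (simp add: matrix_vector_right_distrib matrix_vector_mult_scaleR inner_add_left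
          inner_add_right 2 3 4 inner_commute[of g v] power2_eq_square algebra_simps)
    with 1 show "0 \<le> 2 * t * (g \<bullet> g) + t\<^sup>2 * (g \<bullet> (S *v g) - \<mu> * (g \<bullet> g))" by simp
  qed
  then have "is_eigenvalue S \<mu>"
    using v0 by (auto simp: is_eigenvalue_def g_def)
  moreover have "\<mu> \<le> \<nu>" if nu: "0 < \<nu>" "is_eigenvalue S \<nu>" for \<nu>
  proof -
    obtain w where w: "w \<noteq> 0" "S *v w = \<nu> *\<^sub>R w" using nu by (auto simp: is_eigenvalue_def)
    have "\<nu> * (w \<bullet> u) = 0"
      using symmetric_matrix_inner[OF sym, of w u] ker w(2) by simp
    then have "w \<bullet> u = 0" using nu(1) by simp
    from ray[OF this] w show ?thesis by (simp add: mult_le_cancel_right)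
  qed
  ultimately have "smallest_positive_eigenvalue S = \<mu>"
    unfolding smallest_positive_eigenvalue_def using mu_pos by (intro Least_equality) auto
  then show "0 < smallest_positive_eigenvalue S"
    and "\<And>x. x \<bullet> u = 0 \<Longrightarrow> smallest_positive_eigenvalue S * (x \<bullet> x) \<le> x \<bullet> (S *v x)"
    using mu_pos ray by auto
qed

section \<open>The Laplacian of a weight-balanced, strongly connected digraph\<close>

lemma laplacian_mult_nth:
  "(laplacian A *v x) $ i = (\<Sum>j\<in>UNIV. A $ i $ j * (x $ i - x $ j))"
proof -
  have "(laplacian A *v x) $ i
      = (\<Sum>j\<in>UNIV. (if i = j then (\<Sum>k\<in>UNIV. A $ i $ k) * x $ j else 0) - A $ i $ j * x $ j)"
    unfolding matrix_vector_mult_def by (auto simp: laplacian_def algebra_simps intro!: sum.cong)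
  then show ?thesis
    by (simp add: sum_subtractf right_diff_distrib sum_distrib_right)
qed

text \<open>Write \<open>(x_i - x_j)^2\<close> as
  \<open>2 * x_i * (x_i - x_j) - x_i^2 + x_j^2\<close>. The last two terms cancel in the weighted
  double sum because row sums equal column sums (\<open>sq\<close>).\<close>

lemma laplacian_form:
  fixes x :: "real^'n::finite"
  assumes "weight_balanced A"
  shows "x \<bullet> (laplacian A *v x) = (1/2) * (\<Sum>i\<in>UNIV. \<Sum>j\<in>UNIV. A $ i $ j * (x $ i - x $ j)\<^sup>2)"
proof -
  have sq: "(\<Sum>i\<in>UNIV. \<Sum>j\<in>UNIV. A $ i $ j * (x $ j)\<^sup>2) = (\<Sum>i\<in>UNIV. \<Sum>j\<in>UNIV. A $ i $ j * (x $ i)\<^sup>2)"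
  proof -
    have "(\<Sum>i\<in>UNIV. \<Sum>j\<in>UNIV. A $ i $ j * (x $ j)\<^sup>2) = (\<Sum>j\<in>UNIV. (\<Sum>i\<in>UNIV. A $ i $ j) * (x $ j)\<^sup>2)"
      by (subst sum.swap) (simp add: sum_distrib_right)
    also have "\<dots> = (\<Sum>j\<in>UNIV. (\<Sum>i\<in>UNIV. A $ j $ i) * (x $ j)\<^sup>2)"
      using assms by (simp add: weight_balanced_def)
    finally show ?thesis by (simp add: sum_distrib_right)
  qed
  have "(\<Sum>i\<in>UNIV. \<Sum>j\<in>UNIV. A $ i $ j * (x $ i - x $ j)\<^sup>2)
      = (\<Sum>i\<in>UNIV. \<Sum>j\<in>UNIV. 2 * (x $ i * (A $ i $ j * (x $ i - x $ j)))
          - A $ i $ j * (x $ i)\<^sup>2 + A $ i $ j * (x $ j)\<^sup>2)"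
    by (intro sum.cong refl) (simp add: power2_eq_square algebra_simps)
  also have "\<dots> = (\<Sum>i\<in>UNIV. \<Sum>j\<in>UNIV. 2 * (x $ i * (A $ i $ j * (x $ i - x $ j))))"
    by (simp only: sum.distrib sum_subtractf sq)
  also have "\<dots> = 2 * (x \<bullet> (laplacian A *v x))"
    by (simp add: inner_vec_def laplacian_mult_nth sum_distrib_left)
  finally show ?thesis by simp
qed

text \<open>All summands of the form are nonnegative. If none were positive, \<open>x\<close> would
  be constant along edges, hence along a directed path from \<open>a\<close> to
  \<open>b\<close>.\<close>

lemma laplacian_form_pos:
  fixes x :: "real^'n::finite"
  assumes "weighted_digraph E A" "strongly_connected E" "weight_balanced A"
    and "x $ a \<noteq> x $ b"
  shows "0 < x \<bullet> (laplacian A *v x)"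
proof -
  have A0: "0 \<le> A $ i $ j * (x $ i - x $ j)\<^sup>2" for i j
    using assms(1) by (simp add: weighted_digraph_def)
  have "\<exists>i j. 0 < A $ i $ j * (x $ i - x $ j)\<^sup>2"
  proof (rule ccontr)
    assume "\<not> ?thesis"
    then have z: "\<not> 0 < A $ i $ j * (x $ i - x $ j)\<^sup>2" for i j by blast
    have edge: "x $ j = x $ i" if "(j, i) \<in> E" for i j
      using that z[of i j] assms(1) by (auto simp: weighted_digraph_def zero_less_mult_iff)
    have "(a, b) \<in> E\<^sup>*" using assms(2) by (simp add: strongly_connected_def)
    then have "x $ a = x $ b" by (induction) (auto dest: edge)
    then show False using assms(4) by simp
  qed
  then obtain i j where ij: "0 < A $ i $ j * (x $ i - x $ j)\<^sup>2" by blast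
  have "0 < (\<Sum>j\<in>UNIV. A $ i $ j * (x $ i - x $ j)\<^sup>2)"
    by (rule sum_pos2[of _ j]) (use A0 ij in auto)
  then have "0 < (\<Sum>i\<in>UNIV. \<Sum>j\<in>UNIV. A $ i $ j * (x $ i - x $ j)\<^sup>2)"
    by (rule sum_pos2[where i = i and I = UNIV and f = "\<lambda>i. \<Sum>j\<in>UNIV. A $ i $ j * (x $ i - x $ j)\<^sup>2",
          OF finite UNIV_I]) (intro sum_nonneg A0)
  then show ?thesis by (simp add: laplacian_form[OF assms(3)])
qed

lemma inner_sym_part: "x \<bullet> (sym_part M *v x) = x \<bullet> (M *v x)"
proof -
  have "x \<bullet> (transpose M *v x) = x \<bullet> (M *v x)"
    by (metis dot_lmul_matrix inner_commute vector_transpose_matrix transpose_transpose)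
  then show ?thesis
    by (simp add: sym_part_def matrix_vector_mult_add_rdistrib scaleR_matrix_vector_assoc[symmetric] inner_add_right)
qed

lemma transpose_sym_part: "transpose (sym_part M) = sym_part M"
  by (simp add: sym_part_def transpose_def vec_eq_iff)

text \<open>The rows of a Laplacian sum to zero by construction, its columns by weight
  balance.\<close>

lemma sym_part_laplacian_ones:
  assumes "weight_balanced A"
  shows "sym_part (laplacian A) *v (1 :: real^'n::finite) = 0"
proof -
  have "laplacian A *v 1 = 0" by (simp add: vec_eq_iff laplacian_mult_nth)
  moreover have "transpose (laplacian A) *v 1 = 0"
  proof -
    have "(\<Sum>j\<in>UNIV. transpose (laplacian A) $ i $ j) = 0" for i
    proof -
      have "(\<Sum>j\<in>UNIV. transpose (laplacian A) $ i $ j)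
        = (\<Sum>j\<in>UNIV. (if j = i then \<Sum>k\<in>UNIV. A $ j $ k else 0) - A $ j $ i)"
        by (simp add: laplacian_def transpose_def)
      also have "\<dots> = 0" using assms by (simp add: sum_subtractf weight_balanced_def)
      finally show ?thesis .
    qed
    then show ?thesis by (simp add: vec_eq_iff matrix_vector_mult_def)
  qed
  ultimately show ?thesis
    by (simp add: sym_part_def matrix_vector_mult_add_rdistrib scaleR_matrix_vector_assoc[symmetric])
qed

text \<open>This is the Rayleigh bound with \<open>u = 1\<close>, applied to \<open>x\<close> minus
  its mean. The Laplacian form depends only on differences of entries, so removing the mean leaves
  it unchanged.\<close>

lemma algebraic_connectivity:
  fixes A :: "real^'n::finite^'n"
  assumes card: "CARD('n) \<ge> 2"
    and G: "weighted_digraph E A" "strongly_connected E" "weight_balanced A"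
  defines "\<kappa> \<equiv> smallest_positive_eigenvalue (sym_part (laplacian A))"
  shows "0 < \<kappa>"
    and "\<And>x. \<kappa> * (\<Sum>i\<in>UNIV. (x $ i - (\<Sum>j\<in>UNIV. x $ j) / CARD('n))\<^sup>2) \<le> x \<bullet> (laplacian A *v x)"
proof -
  have inner1: "x \<bullet> 1 = (\<Sum>i\<in>UNIV. x $ i)" for x :: "real^'n"
    by (simp add: inner_vec_def)
  have pos: "0 < x \<bullet> (sym_part (laplacian A) *v x)" if "x \<bullet> 1 = 0" "x \<noteq> 0" for x
  proof -
    have "\<exists>a b. x $ a \<noteq> x $ b"
    proof (rule ccontr)
      assume "\<not> ?thesis"
      then have eq: "x $ a = x $ b" for a b by blast
      have "x \<bullet> 1 = (\<Sum>i\<in>(UNIV::'n set). x $ b)" for b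
        unfolding inner1 by (intro sum.cong refl eq)
      then have "x = 0" using that(1) by (simp add: vec_eq_iff)
      then show False using that(2) by simp
    qed
    then show ?thesis using laplacian_form_pos[OF G] by (auto simp: inner_sym_part)
  qed
  have ex: "\<exists>x::real^'n. x \<noteq> 0 \<and> x \<bullet> 1 = 0"
  proof -
    have "\<exists>a b::'n. a \<noteq> b"
      using card card_le_Suc0_iff_eq[of "UNIV :: 'n set"] by fastforce
    then obtain a b :: 'n where ab: "a \<noteq> b" by blast
    \<comment> \<open>Two distinct players give a nonzero vector with zero sum, so the complement of
      the ones vector is nontrivial.\<close>
    define x :: "real^'n" where "x = axis a 1 - axis b 1"
    have "x $ a = 1" using ab by (simp add: x_def axis_def)
    moreover have "x \<bullet> 1 = 0" by (simp add: x_def inner_diff_left inner_axis')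
    ultimately show ?thesis by (metis zero_index zero_neq_one)
  qed
  note ray = smallest_positive_eigenvalue_rayleigh[OF transpose_sym_part
      sym_part_laplacian_ones[OF G(3)] pos ex, folded \<kappa>_def, unfolded inner_sym_part]
  show "0 < \<kappa>" by (rule ray(1))
  fix x :: "real^'n"
  define m where "m = (\<Sum>j\<in>UNIV. x $ j) / CARD('n)"
  define y :: "real^'n" where "y = (\<chi> i. x $ i - m)"
  have "y \<bullet> 1 = 0" by (simp add: inner1 y_def sum_subtractf m_def)
  then have "\<kappa> * (y \<bullet> y) \<le> y \<bullet> (laplacian A *v y)" using ray(2)[of y] by blast
  also have "\<dots> = x \<bullet> (laplacian A *v x)"
    by (simp add: laplacian_form[OF G(3)] y_def)
  finally show "\<kappa> * (\<Sum>i\<in>UNIV. (x $ i - (\<Sum>j\<in>UNIV. x $ j) / CARD('n))\<^sup>2) \<le> x \<bullet> (laplacian A *v x)"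
    by (simp add: inner_vec_def y_def m_def power2_eq_square)
qed

text \<open>The factor \<open>I_N\<close> in the Kronecker product decouples coordinates:
  \<open>X k\<close> collects the \<open>k\<close>-th coordinate of all blocks, and the scalar bound
  is summed over \<open>k\<close>.\<close>

lemma disagreement_bound:
  fixes A :: "real^'n::finite^'n" and e :: "'n \<Rightarrow> real^'k::finite"
  assumes "CARD('n) \<ge> 2" "weighted_digraph E A" "strongly_connected E" "weight_balanced A"
  shows "smallest_positive_eigenvalue (sym_part (laplacian A))
      * (\<Sum>i\<in>UNIV. (norm (e i - (\<Sum>j\<in>UNIV. e j) /\<^sub>R CARD('n)))\<^sup>2)
    \<le> (\<Sum>i\<in>UNIV. e i \<bullet> (\<Sum>j\<in>UNIV. A $ i $ j *\<^sub>R (e i - e j)))"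
    (is "?\<kappa> * ?D \<le> ?Q")
proof -
  define X :: "'k \<Rightarrow> real^'n" where "X k = (\<chi> i. e i $ k)" for k
  have "?D = (\<Sum>i\<in>UNIV. \<Sum>k\<in>UNIV. (X k $ i - (\<Sum>j\<in>UNIV. X k $ j) / CARD('n))\<^sup>2)"
    by (simp only: power2_norm_eq_inner inner_vec_def)
       (simp add: X_def power2_eq_square divide_inverse mult.commute)
  also have "\<dots> = (\<Sum>k\<in>UNIV. \<Sum>i\<in>UNIV. (X k $ i - (\<Sum>j\<in>UNIV. X k $ j) / CARD('n))\<^sup>2)"
    by (rule sum.swap)
  finally have "?\<kappa> * ?D
      = (\<Sum>k\<in>UNIV. ?\<kappa> * (\<Sum>i\<in>UNIV. (X k $ i - (\<Sum>j\<in>UNIV. X k $ j) / CARD('n))\<^sup>2))"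
    by (simp add: sum_distrib_left)
  also have "\<dots> \<le> (\<Sum>k\<in>UNIV. X k \<bullet> (laplacian A *v X k))"
    by (intro sum_mono algebraic_connectivity(2)[OF assms])
  also have "\<dots> = (\<Sum>k\<in>UNIV. \<Sum>i\<in>UNIV. e i $ k * (\<Sum>j\<in>UNIV. A $ i $ j * (e i $ k - e j $ k)))"
    by (simp add: inner_vec_def laplacian_mult_nth X_def)
  also have "\<dots> = (\<Sum>i\<in>UNIV. \<Sum>k\<in>UNIV. e i $ k * (\<Sum>j\<in>UNIV. A $ i $ j * (e i $ k - e j $ k)))"
    by (rule sum.swap)
  also have "\<dots> = ?Q" by (simp add: inner_vec_def)
  finally show ?thesis .
qed

section \<open>Nash equilibria as zeros of the pseudogradient\<close>

lemma deviate_self: "deviate z i (z $ i) = z"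
  by (simp add: deviate_def vec_eq_iff)

lemma deviate_eq: "deviate z i x = z + (x - z $ i) *\<^sub>R axis i 1"
  by (simp add: deviate_def vec_eq_iff axis_def)

text \<open>The value of \<open>deriv\<close> is meaningful only under differentiability, which the
  chain rule along the line of deviations of player \<open>i\<close> provides.\<close>

lemma own_partial_has_derivative:
  assumes "twice_continuously_differentiable (J i)"
  shows "((\<lambda>x. J i (deviate z i x)) has_real_derivative own_partial J i z) (at (z $ i))"
proof -
  obtain f' where f': "\<And>x. (J i has_derivative blinfun_apply (f' x)) (at x)"
    using assms unfolding twice_continuously_differentiable_def by blast
  have "((\<lambda>x. deviate z i x) has_derivative (\<lambda>h. h *\<^sub>R axis i 1)) (at (z $ i))"
    unfolding deviate_eq by (auto intro!: derivative_eq_intros)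
  from has_derivative_compose[OF this f']
  have "(\<lambda>x. J i (deviate z i x)) differentiable (at (z $ i))"
    by (auto simp: differentiable_def)
  then show ?thesis
    unfolding own_partial_def by (simp add: DERIV_deriv_iff_real_differentiable)
qed

lemma strictly_convex_imp_convex_on:
  assumes "strictly_convex f"
  shows "convex_on UNIV f"
proof (rule convex_onI)
  fix t x y :: real
  assume t: "0 < t" "t < 1"
  show "f ((1 - t) *\<^sub>R x + t *\<^sub>R y) \<le> (1 - t) * f x + t * f y"
  proof (cases "x = y")
    case True
    then show ?thesis by (simp add: algebra_simps)
  next
    case False
    then show ?thesis using assms t by (auto simp: strictly_convex_def intro: less_imp_le)
  qed
qed simp

text \<open>Necessity is Fermat's rule in each own variable. Sufficiency holds because a convex
  function lies above its horizontal tangent.\<close>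

lemma nash_equilibrium_iff_pseudogradient_zero:
  assumes diff: "\<And>i. twice_continuously_differentiable (J i)"
    and conv: "\<And>i z. strictly_convex (\<lambda>x. J i (deviate z i x))"
  shows "nash_equilibrium J zs \<longleftrightarrow> pseudogradient J zs = 0"
proof
  assume ne: "nash_equilibrium J zs"
  have "own_partial J i zs = 0" for i
  proof (rule DERIV_local_min[OF own_partial_has_derivative[OF diff], of 1])
    show "\<forall>y. \<bar>zs $ i - y\<bar> < 1 \<longrightarrow> J i (deviate zs i (zs $ i)) \<le> J i (deviate zs i y)"
      using ne by (simp add: nash_equilibrium_def deviate_self)
  qed simp
  then show "pseudogradient J zs = 0" by (simp add: pseudogradient_def vec_eq_iff)
next
  assume z: "pseudogradient J zs = 0"
  have "J i zs \<le> J i (deviate zs i x)" for i x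
  proof -
    have "own_partial J i zs = 0" using z by (simp add: pseudogradient_def vec_eq_iff)
    then have "((\<lambda>x. J i (deviate zs i x)) has_real_derivative 0) (at (zs $ i))"
      using own_partial_has_derivative[where J = J and i = i and z = zs, OF diff] by simp
    with strictly_convex_imp_convex_on[OF conv]
    have "J i (deviate zs i x) - J i (deviate zs i (zs $ i)) \<ge> 0 * (x - zs $ i)"
      by (intro convex_on_imp_above_tangent[where A = UNIV]) auto
    then show ?thesis by (simp add: deviate_self)
  qed
  then show "nash_equilibrium J zs" by (simp add: nash_equilibrium_def)
qed

section \<open>Existence and uniqueness of the zero\<close>

lemma norm_diff_sq:
  fixes x y :: "'a::real_inner"
  shows "(norm (x - t *\<^sub>R y))\<^sup>2 = (norm x)\<^sup>2 - 2 * (t * (x \<bullet> y)) + t\<^sup>2 * (norm y)\<^sup>2"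
  unfolding power2_norm_eq_inner
  by (simp add: inner_diff_left inner_diff_right inner_commute[of y x] power2_eq_square algebra_simps)

text \<open>The zeros of \<open>F\<close> are the fixed points of the gradient-type step
  \<open>x - \<tau> *\<^sub>R F x\<close>, a contraction for suitable \<open>\<tau>\<close>, so
  Banach's theorem applies.\<close>

lemma strongly_monotone_lipschitz_unique_zero:
  fixes F :: "'a::euclidean_space \<Rightarrow> 'a"
  assumes "0 < m" "0 < L" and mono: "strongly_monotone m F" and lip: "L-lipschitz_on UNIV F"
  shows "\<exists>!x. F x = 0"
proof -
  \<comment> \<open>This step size minimizes the squared contraction factor
    \<open>1 - 2 * \<tau> * m + \<tau>^2 * L^2\<close>, with minimum
    \<open>1 - \<tau> * m\<close>.\<close>
  define \<tau> where "\<tau> = m / L\<^sup>2"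
  have tau: "0 < \<tau>" using assms by (simp add: \<tau>_def)
  define c where "c = sqrt \<bar>1 - \<tau> * m\<bar>"
  have key: "(norm ((x - \<tau> *\<^sub>R F x) - (y - \<tau> *\<^sub>R F y)))\<^sup>2 \<le> (1 - \<tau> * m) * (norm (x - y))\<^sup>2" for x y
  proof -
    have F: "norm (F x - F y) \<le> L * norm (x - y)"
      using lip by (auto simp: lipschitz_on_def dist_norm)
    then have F2: "(norm (F x - F y))\<^sup>2 \<le> L\<^sup>2 * (norm (x - y))\<^sup>2"
      by (metis norm_ge_zero power_mono power_mult_distrib)
    have M: "m * (norm (x - y))\<^sup>2 \<le> (x - y) \<bullet> (F x - F y)"
      using mono by (auto simp: strongly_monotone_def)
    have "(x - \<tau> *\<^sub>R F x) - (y - \<tau> *\<^sub>R F y) = (x - y) - \<tau> *\<^sub>R (F x - F y)"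
      by (simp add: algebra_simps)
    then have "(norm ((x - \<tau> *\<^sub>R F x) - (y - \<tau> *\<^sub>R F y)))\<^sup>2
        = (norm (x - y))\<^sup>2 - 2 * (\<tau> * ((x - y) \<bullet> (F x - F y))) + \<tau>\<^sup>2 * (norm (F x - F y))\<^sup>2"
      by (simp only: norm_diff_sq)
    also have "\<dots> \<le> (norm (x - y))\<^sup>2 - 2 * (\<tau> * (m * (norm (x - y))\<^sup>2)) + \<tau>\<^sup>2 * (L\<^sup>2 * (norm (x - y))\<^sup>2)"
      using F2 M tau by (intro add_mono diff_mono mult_left_mono) auto
    also have "\<tau>\<^sup>2 * (L\<^sup>2 * (norm (x - y))\<^sup>2) = \<tau> * (m * (norm (x - y))\<^sup>2)"
      using assms(2) by (simp add: \<tau>_def power2_eq_square)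
    finally show ?thesis by (simp add: algebra_simps)
  qed
  \<comment> \<open>For a unit vector and \<open>0\<close>, \<open>key\<close> bounds a square by
    this number, which is therefore nonnegative; the absolute value in \<open>c\<close> then drops
    out.\<close>
  have c1: "1 - \<tau> * m \<ge> 0"
  proof -
    obtain b :: 'a where "norm b = 1" by (metis norm_Basis nonempty_Basis ex_in_conv)
    have "0 \<le> (norm ((b - \<tau> *\<^sub>R F b) - (0 - \<tau> *\<^sub>R F 0)))\<^sup>2" by simp
    also have "\<dots> \<le> (1 - \<tau> * m) * (norm (b - 0))\<^sup>2" by (rule key)
    finally show ?thesis using \<open>norm b = 1\<close> by simp
  qed
  have "\<exists>!x. x - \<tau> *\<^sub>R F x = x"
  proof (rule banach_fix_type[where c = c])
    show "0 \<le> c" by (simp add: c_def)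
    show "c < 1" using c1 tau assms(1) by (simp add: c_def)
    have "dist (x - \<tau> *\<^sub>R F x) (y - \<tau> *\<^sub>R F y) \<le> c * dist x y" for x y
      unfolding dist_norm
      by (rule power2_le_imp_le) (use key[of x y] c1 in \<open>simp_all add: c_def power_mult_distrib\<close>)
    then show "\<forall>x y. dist (x - \<tau> *\<^sub>R F x) (y - \<tau> *\<^sub>R F y) \<le> c * dist x y" by blast
  qed
  then show ?thesis using tau by simp
qed

section \<open>A scalar decay estimate and positive definite binary forms\<close>

text \<open>Gronwall's argument: with the integrating factor \<open>exp (k * s)\<close> the function
  becomes nonincreasing.\<close>

lemma exponential_decay:
  fixes V V' :: "real \<Rightarrow> real"
  assumes der: "\<And>t. 0 \<le> t \<Longrightarrow> (V has_real_derivative V' t) (at t within {0..})"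
    and le: "\<And>t. 0 \<le> t \<Longrightarrow> V' t \<le> - (k * V t)"
    and "0 \<le> t"
  shows "V t \<le> V 0 * exp (- k * t)"
proof -
  define W where "W s = V s * exp (k * s)" for s
  have W': "(W has_real_derivative (V' s + k * V s) * exp (k * s)) (at s within {0..})" if "0 \<le> s" for s
    unfolding W_def using der[OF that] by (auto intro!: derivative_eq_intros simp: algebra_simps)
  have "W t \<le> W 0"
  proof (rule DERIV_nonpos_imp_decreasing_open[OF \<open>0 \<le> t\<close>])
    \<comment> \<open>Away from \<open>0\<close> the derivative within the half-line is two-sided;
      at the endpoints continuity suffices.\<close>
    fix s :: real assume s: "0 < s" "s < t"
    have "(W has_real_derivative (V' s + k * V s) * exp (k * s)) (at s)"
      using W'[of s] s at_within_interior[of s "{0..}"] by simp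
    moreover have "(V' s + k * V s) * exp (k * s) \<le> 0"
      using le[of s] s by (intro mult_nonpos_nonneg) auto
    ultimately show "\<exists>y. (W has_real_derivative y) (at s) \<and> y \<le> 0" by blast
  next
    have "continuous_on {0..} W"
      using W' by (intro DERIV_continuous_on) auto
    then show "continuous_on {0..t} W" by (rule continuous_on_subset) auto
  qed
  then have "V t * exp (k * t) \<le> V 0" by (simp add: W_def)
  then show ?thesis by (simp add: exp_minus field_simps)
qed

text \<open>The witness \<open>k\<close> is determinant over trace of the matrix of the form, which
  lies below its smaller eigenvalue.\<close>

lemma positive_definite_2x2_bound:
  fixes a b c :: real
  assumes "0 < a" "b\<^sup>2 < a * c"
  obtains k where "0 < k" "\<And>x y. k * (x\<^sup>2 + y\<^sup>2) \<le> a * x\<^sup>2 - 2 * b * x * y + c * y\<^sup>2"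
proof -
  have c: "0 < c" using assms by (metis zero_less_mult_pos le_less_trans zero_le_power2)
  define k where "k = (a * c - b\<^sup>2) / (a + c)"
  have k: "0 < k" using assms c by (simp add: k_def)
  have kk: "k * (a + c) = a * c - b\<^sup>2" using assms c by (simp add: k_def)
  have ka: "k < a"
  proof -
    have "0 < a * a + b\<^sup>2" using assms(1) by (simp add: add_pos_nonneg)
    then have "k * (a + c) < a * (a + c)" unfolding kk by (simp add: distrib_left)
    then show ?thesis using assms(1) c by simp
  qed
  have "k * (x\<^sup>2 + y\<^sup>2) \<le> a * x\<^sup>2 - 2 * b * x * y + c * y\<^sup>2" for x y
  proof -
    \<comment> \<open>Complete the square after multiplying by \<open>a - k > 0\<close>. By the
      choice of \<open>k\<close> the remaining coefficient of \<open>y^2\<close> is just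
      \<open>k^2\<close>.\<close>
    have "(a - k) * (a * x\<^sup>2 - 2 * b * x * y + c * y\<^sup>2 - k * (x\<^sup>2 + y\<^sup>2))
      = ((a - k) * x - b * y)\<^sup>2 + (a * c - b\<^sup>2 - k * (a + c) + k\<^sup>2) * y\<^sup>2"
      by (simp add: power2_eq_square algebra_simps)
    also have "\<dots> \<ge> 0" unfolding kk by simp
    finally show ?thesis using ka by (simp add: zero_le_mult_iff)
  qed
  with k show ?thesis by (rule that)
qed

section \<open>Stacked vectors and the consensus subspace\<close>

lemma inner_blocks:
  fixes X Y :: "real^('n::finite \<times> 'n)"
  shows "X \<bullet> Y = (\<Sum>i\<in>UNIV. block X i \<bullet> block Y i)"
  by (simp add: inner_vec_def block_def sum.cartesian_product case_prod_unfold flip: UNIV_Times_UNIV)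

lemma block_diff: "block (X - Y) i = block X i - block Y i"
  by (simp add: block_def vec_eq_iff)

text \<open>The consensus state, the Kronecker product of the ones vector with
  \<open>z\<close>.\<close>

definition replicate_blocks :: "real^'n \<Rightarrow> real^('n::finite \<times> 'n)" where
  "replicate_blocks z = (\<chi> p. z $ snd p)"

lemma block_replicate_blocks [simp]: "block (replicate_blocks z) i = z"
  by (simp add: block_def replicate_blocks_def vec_eq_iff)

lemma extended_pseudogradient_replicate_blocks [simp]:
  "extended_pseudogradient J (replicate_blocks z) = pseudogradient J z"
  by (simp add: extended_pseudogradient_def pseudogradient_def vec_eq_iff)

lemma norm_blocks: "(norm X)\<^sup>2 = (\<Sum>i\<in>UNIV. (norm (block X i))\<^sup>2)"
  by (simp add: power2_norm_eq_inner inner_blocks)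

lemma norm_block_le: "norm (block X i) \<le> norm X"
proof (rule power2_le_imp_le)
  show "(norm (block X i))\<^sup>2 \<le> (norm X)\<^sup>2"
    unfolding norm_blocks[of X] by (rule member_le_sum) auto
qed simp

lemma norm_diagonal_le:
  fixes X :: "real^('n::finite \<times> 'n)"
  shows "norm (\<chi> i. X $ (i, i)) \<le> norm X"
proof (rule power2_le_imp_le)
  have "(X $ (i, i))\<^sup>2 \<le> (norm (block X i))\<^sup>2" for i
    using power_mono[OF component_le_norm_cart[of "block X i" i], of 2] by (simp add: block_def)
  then have "(\<Sum>i\<in>UNIV. (X $ (i, i))\<^sup>2) \<le> (norm X)\<^sup>2"
    unfolding norm_blocks by (rule sum_mono)
  then show "(norm (\<chi> i. X $ (i, i)))\<^sup>2 \<le> (norm X)\<^sup>2"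
    by (simp add: power2_norm_eq_inner[of "vec_lambda _"] inner_vec_def power2_eq_square[of "_ $ _"])
qed simp

text \<open>Blocks summing to zero are orthogonal to every consensus state, so Pythagoras
  applies.\<close>

lemma norm_add_replicate_blocks:
  fixes m :: "real^'n::finite"
  assumes "(\<Sum>i\<in>UNIV. block D i) = 0"
  shows "(norm (replicate_blocks m + D))\<^sup>2 = CARD('n) * (norm m)\<^sup>2 + (norm D)\<^sup>2"
proof -
  have "replicate_blocks m \<bullet> D = m \<bullet> (\<Sum>i\<in>UNIV. block D i)"
    by (simp add: inner_blocks inner_sum_right)
  then have "replicate_blocks m \<bullet> D = 0" using assms by simp
  then have "(norm (replicate_blocks m + D))\<^sup>2 = (norm (replicate_blocks m))\<^sup>2 + (norm D)\<^sup>2"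
    by (simp add: power2_norm_eq_inner inner_add_left inner_add_right inner_commute)
  then show ?thesis by (simp add: norm_blocks[of "replicate_blocks m"])
qed

section \<open>Dissipation along the seeking dynamics\<close>

lemma seeking_field_dissipation:
  fixes J :: "'n::finite \<Rightarrow> real^'n \<Rightarrow> real" and A :: "real^'n^'n"
    and Z :: "real^('n \<times> 'n)" and zs :: "real^'n"
  assumes G: "CARD('n) \<ge> 2" "weighted_digraph E A" "strongly_connected E" "weight_balanced A"
    and "0 \<le> \<alpha>"
    and mono: "strongly_monotone l_low (pseudogradient J)"
    and lip: "l-lipschitz_on UNIV (pseudogradient J)"
    and lipe: "l-lipschitz_on UNIV (extended_pseudogradient J)"
    and zero: "pseudogradient J zs = 0"
  defines "m \<equiv> (\<Sum>i\<in>UNIV. block Z i - zs) /\<^sub>R CARD('n)"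
  defines "D \<equiv> Z - replicate_blocks (zs + m)"
  shows "(Z - replicate_blocks zs) \<bullet> seeking_field J A \<alpha> Z
      \<le> - (l_low * (norm m)\<^sup>2 - 2 * l * norm m * norm D
          + (\<alpha> * smallest_positive_eigenvalue (sym_part (laplacian A)) - l) * (norm D)\<^sup>2)"
    and "(norm (Z - replicate_blocks zs))\<^sup>2 = CARD('n) * (norm m)\<^sup>2 + (norm D)\<^sup>2"
proof -
  define e where "e i = block Z i - zs" for i
  \<comment> \<open>\<open>r\<close> is the disagreement about each player's own decision. Pairing
    the error with the gradient term sees only these own entries, that is
    \<open>m + r\<close>.\<close>
  define r :: "real^'n" where "r = (\<chi> i. D $ (i, i))"
  define p where "p = extended_pseudogradient J Z"
  define q where "q = pseudogradient J (zs + m)"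
  let ?\<kappa> = "smallest_positive_eigenvalue (sym_part (laplacian A))"
  have blockD: "block D i = e i - m" for i by (simp add: D_def e_def block_diff)
  have m: "m = (\<Sum>i\<in>UNIV. e i) /\<^sub>R CARD('n)" by (simp add: m_def e_def)
  have lap: "?\<kappa> * (norm D)\<^sup>2 \<le> (\<Sum>i\<in>UNIV. e i \<bullet> (\<Sum>j\<in>UNIV. A $ i $ j *\<^sub>R (e i - e j)))"
    using disagreement_bound[OF G, of e] by (simp add: norm_blocks[of D] blockD m)
  have diag: "e i $ i = (m + r) $ i" for i
    by (simp add: r_def D_def e_def block_def replicate_blocks_def)
  have field: "(Z - replicate_blocks zs) \<bullet> seeking_field J A \<alpha> Z
      = - (\<alpha> * (\<Sum>i\<in>UNIV. e i \<bullet> (\<Sum>j\<in>UNIV. A $ i $ j *\<^sub>R (e i - e j)))) - (m + r) \<bullet> p"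
  proof -
    have "(Z - replicate_blocks zs) \<bullet> seeking_field J A \<alpha> Z
        = (\<Sum>i\<in>UNIV. e i \<bullet> (- (\<alpha> *\<^sub>R (\<Sum>j\<in>UNIV. A $ i $ j *\<^sub>R (e i - e j))) - p $ i *\<^sub>R axis i 1))"
      by (simp add: inner_blocks block_diff block_seeking_field e_def p_def extended_pseudogradient_def)
    also have "\<dots> = (\<Sum>i\<in>UNIV. - (\<alpha> * (e i \<bullet> (\<Sum>j\<in>UNIV. A $ i $ j *\<^sub>R (e i - e j)))) - (m + r) $ i * p $ i)"
      by (simp add: inner_diff_right inner_axis diag del: vector_add_component)
         (simp add: mult.commute)
    also have "\<dots> = - (\<alpha> * (\<Sum>i\<in>UNIV. e i \<bullet> (\<Sum>j\<in>UNIV. A $ i $ j *\<^sub>R (e i - e j)))) - (m + r) \<bullet> p"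
      by (simp add: sum_subtractf sum_negf sum_distrib_left inner_vec_def)
    finally show ?thesis .
  qed
  have l0: "0 \<le> l" using lip by (rule lipschitz_on_nonneg)
  have r: "norm r \<le> norm D" unfolding r_def by (rule norm_diagonal_le)
  \<comment> \<open>On consensus states the extended pseudogradient is the pseudogradient, so
    \<open>p\<close> and \<open>q\<close> are its values at two states differing by
    \<open>D\<close>.\<close>
  have pq: "norm (p - q) \<le> l * norm D"
    using lipschitz_onD[OF lipe, of Z "replicate_blocks (zs + m)"]
    by (simp add: p_def q_def D_def dist_norm)
  have q: "norm q \<le> l * norm m"
    using lipschitz_onD[OF lip, of "zs + m" zs] by (simp add: q_def zero dist_norm)
  have 1: "l_low * (norm m)\<^sup>2 \<le> m \<bullet> q"
    using mono[unfolded strongly_monotone_def, rule_format, of "zs + m" zs] by (simp add: q_def zero)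
  have 2: "- (r \<bullet> q) \<le> norm D * (l * norm m)"
    by (rule order_trans[OF _ mult_mono[OF r q]]) (use norm_cauchy_schwarz[of "- r" q] in auto)
  have 3: "- (m \<bullet> (p - q)) \<le> norm m * (l * norm D)"
    by (rule order_trans[OF _ mult_left_mono[OF pq]])
       (use norm_cauchy_schwarz[of "- m" "p - q"] in auto)
  have 4: "- (r \<bullet> (p - q)) \<le> norm D * (l * norm D)"
    by (rule order_trans[OF _ mult_mono[OF r pq]]) (use norm_cauchy_schwarz[of "- r" "p - q"] in auto)
  \<comment> \<open>Only \<open>m \<bullet> q\<close> is dissipative, by strong monotonicity. The
    two mixed terms together give \<open>2 * l * norm m * norm D\<close>, and the last one reduces
    the Laplacian's gain by \<open>l\<close>.\<close>
  have 5: "(m + r) \<bullet> p = m \<bullet> q + r \<bullet> q + m \<bullet> (p - q) + r \<bullet> (p - q)"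
    by (simp add: algebra_simps)
  have 6: "\<alpha> * (?\<kappa> * (norm D)\<^sup>2) \<le> \<alpha> * (\<Sum>i\<in>UNIV. e i \<bullet> (\<Sum>j\<in>UNIV. A $ i $ j *\<^sub>R (e i - e j)))"
    using lap \<open>0 \<le> \<alpha>\<close> by (rule mult_left_mono)
  show "(Z - replicate_blocks zs) \<bullet> seeking_field J A \<alpha> Z
      \<le> - (l_low * (norm m)\<^sup>2 - 2 * l * norm m * norm D + (\<alpha> * ?\<kappa> - l) * (norm D)\<^sup>2)"
    unfolding field 5 using 1 2 3 4 6 by (simp add: algebra_simps power2_eq_square)
  have "(\<Sum>i\<in>UNIV. block D i) = 0"
    by (simp add: blockD sum_subtractf m sum_constant_scaleR del: sum_constant)
  from norm_add_replicate_blocks[OF this, of m]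
  show "(norm (Z - replicate_blocks zs))\<^sup>2 = CARD('n) * (norm m)\<^sup>2 + (norm D)\<^sup>2"
  proof -
    have "replicate_blocks m + D = Z - replicate_blocks zs"
      by (simp add: D_def replicate_blocks_def vec_eq_iff)
    with \<open>(norm (replicate_blocks m + D))\<^sup>2 = _\<close> show ?thesis by simp
  qed
qed

section \<open>Exponential convergence of trajectories\<close>

lemma trajectory_converges_exponentially:
  fixes f :: "'a::real_inner \<Rightarrow> 'a"
  assumes traj: "is_trajectory f z" and "0 < k"
    and diss: "\<And>x. (x - xs) \<bullet> f x \<le> - (k * (norm (x - xs))\<^sup>2)"
  shows "converges_exponentially z xs"
proof -
  define V where "V t = (norm (z t - xs))\<^sup>2" for t
  have der: "(V has_real_derivative 2 * ((z t - xs) \<bullet> f (z t))) (at t within {0..})" if "0 \<le> t" for t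
  proof -
    have "(z has_derivative (\<lambda>h. h *\<^sub>R f (z t))) (at t within {0..})"
      using traj that by (auto simp: is_trajectory_def has_vector_derivative_def)
    then show ?thesis
      unfolding V_def power2_norm_eq_inner has_field_derivative_def
      by (auto intro!: derivative_eq_intros simp: inner_commute algebra_simps fun_eq_iff)
  qed
  have dec: "V t \<le> V 0 * exp (- (2 * k) * t)" if "0 \<le> t" for t
    by (rule exponential_decay[OF der _ that]) (use diss in \<open>auto simp: V_def\<close>)
  \<comment> \<open>Taking roots halves the rate \<open>2 * k\<close>. The \<open>+ 1\<close> keeps
    the constant positive when the trajectory starts at \<open>xs\<close>.\<close>
  have "norm (z t - xs) \<le> (norm (z 0 - xs) + 1) * exp (- k * t)" if "0 \<le> t" for t
  proof -
    have "norm (z t - xs) \<le> norm (z 0 - xs) * exp (- k * t)"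
    proof (rule power2_le_imp_le)
      show "(norm (z t - xs))\<^sup>2 \<le> (norm (z 0 - xs) * exp (- k * t))\<^sup>2"
        using dec[OF that] by (simp add: V_def power_mult_distrib exp_double[symmetric] mult.assoc)
    qed simp
    also have "\<dots> \<le> (norm (z 0 - xs) + 1) * exp (- k * t)" by (intro mult_right_mono) auto
    finally show ?thesis .
  qed
  then show ?thesis
    unfolding converges_exponentially_def using \<open>0 < k\<close>
    by (intro exI[of _ "norm (z 0 - xs) + 1"] exI[of _ k] conjI) (auto intro: add_nonneg_pos)
qed

theorem theorem1:
  fixes J :: "'n::finite \<Rightarrow> real^'n \<Rightarrow> real"
    and E :: "('n \<times> 'n) set"
    and A :: "real^'n^'n"
    and l_low l_up l_F l \<alpha> :: real
  assumes "CARD('n) \<ge> 2"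
    and "weighted_digraph E A"
    and "\<And>i. twice_continuously_differentiable (J i)"
    and "\<And>i z. strictly_convex (\<lambda>x. J i (deviate z i x))"
    and "\<And>i z. radially_unbounded (\<lambda>x. J i (deviate z i x))"
    and "l_low > 0" and "l_up > 0"
    and "strongly_monotone l_low (pseudogradient J)"
    and "l_up-lipschitz_on UNIV (pseudogradient J)"
    and "l_F > 0"
    and "l_F-lipschitz_on UNIV (extended_pseudogradient J)"
    and "strongly_connected E"
    and "weight_balanced A"
    and "l = max l_up l_F"
    and "\<alpha> > 1 / smallest_positive_eigenvalue (sym_part (laplacian A)) * (l\<^sup>2 / l_low + l)"
  shows "(\<exists>!zs. nash_equilibrium J zs) \<and>
    (\<forall>zs z. nash_equilibrium J zs \<longrightarrow> is_trajectory (seeking_field J A \<alpha>) z \<longrightarrow>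
      (\<forall>i. converges_exponentially (\<lambda>t. block (z t) i) zs))"
proof (intro conjI allI impI)
  note ne_iff = nash_equilibrium_iff_pseudogradient_zero[of J, OF assms(3,4)]
  show "\<exists>!zs. nash_equilibrium J zs"
    unfolding ne_iff by (rule strongly_monotone_lipschitz_unique_zero[OF assms(6-9)])
  fix zs z i
  assume ne: "nash_equilibrium J zs" and traj: "is_trajectory (seeking_field J A \<alpha>) z"
  note G = assms(1,2,12,13)
  define \<kappa> where "\<kappa> = smallest_positive_eigenvalue (sym_part (laplacian A))"
  have \<kappa>: "0 < \<kappa>" unfolding \<kappa>_def by (rule algebraic_connectivity(1)[OF G])
  have l: "0 < l" "l_up \<le> l" "l_F \<le> l" using assms(7,14) by auto
  have gain: "l\<^sup>2 / l_low + l < \<alpha> * \<kappa>"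
    using assms(15) \<kappa> unfolding \<kappa>_def[symmetric] by (simp add: pos_divide_less_eq)
  then have "0 < \<alpha> * \<kappa>"
    using l assms(6) by (smt (verit) divide_nonneg_pos zero_le_power2)
  then have "0 \<le> \<alpha>" using \<kappa> by (simp add: zero_less_mult_iff)
  \<comment> \<open>This is the determinant condition for the form with diagonal
    \<open>l_low\<close>, \<open>\<alpha> * \<kappa> - l\<close> and off-diagonal entry
    \<open>- l\<close>.\<close>
  have "l\<^sup>2 < l_low * (\<alpha> * \<kappa> - l)" using gain assms(6) by (simp add: field_simps)
  then obtain k where k: "0 < k"
    "\<And>x y. k * (x\<^sup>2 + y\<^sup>2) \<le> l_low * x\<^sup>2 - 2 * l * x * y + (\<alpha> * \<kappa> - l) * y\<^sup>2"
    by (rule positive_definite_2x2_bound[OF assms(6)]) blast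
  have "(Z - replicate_blocks zs) \<bullet> seeking_field J A \<alpha> Z
      \<le> - (k / CARD('n) * (norm (Z - replicate_blocks zs))\<^sup>2)" for Z
  proof -
    define m where "m = (\<Sum>i\<in>UNIV. block Z i - zs) /\<^sub>R CARD('n)"
    define D where "D = Z - replicate_blocks (zs + m)"
    note diss = seeking_field_dissipation[OF G \<open>0 \<le> \<alpha>\<close> assms(8)
        lipschitz_on_le[OF assms(9) l(2)] lipschitz_on_le[OF assms(11) l(3)]
        ne[unfolded ne_iff], of Z, folded \<kappa>_def m_def, folded D_def]
    \<comment> \<open>The mean error is counted once per block in the total norm, which costs the
      rate a factor \<open>CARD('n)\<close>.\<close>
    have "k / CARD('n) * (norm (Z - replicate_blocks zs))\<^sup>2
        \<le> k / CARD('n) * (CARD('n) * ((norm m)\<^sup>2 + (norm D)\<^sup>2))"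
      unfolding diss(2) using k(1) assms(1)
      by (intro mult_left_mono) (auto simp: distrib_left mult_le_cancel_right1)
    also have "\<dots> = k * ((norm m)\<^sup>2 + (norm D)\<^sup>2)" by simp
    also note k(2)[of "norm m" "norm D"]
    finally show ?thesis using diss(1) by linarith
  qed
  with traj have "converges_exponentially z (replicate_blocks zs)"
    by (intro trajectory_converges_exponentially[where k = "k / CARD('n)"]) (use k(1) in auto)
  then obtain c \<beta> where cb: "0 < c" "0 < \<beta>"
      "\<And>t. 0 \<le> t \<Longrightarrow> norm (z t - replicate_blocks zs) \<le> c * exp (- \<beta> * t)"
    by (auto simp: converges_exponentially_def)
  have "norm (block (z t) i - zs) \<le> c * exp (- \<beta> * t)" if "0 \<le> t" for t
    using norm_block_le[of "z t - replicate_blocks zs" i] cb(3)[OF that] by (simp add: block_diff)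
  then show "converges_exponentially (\<lambda>t. block (z t) i) zs"
    unfolding converges_exponentially_def using cb(1,2) by blast
qed

end
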